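(* Let $\alpha\in(0,1)\cup(1,2)$ and let $X$ be a random variable with characteristic function $\mathbb{E}e^{itX}=\exp\left(-2\int_0^\infty(1-\cos(tx))\frac{dx}{x^{\alpha+1}}\right)$, $t\in\mathbb{R}$. Then for every $y>0$, $$\mathbb{P}(X\ge y)\ge\frac12\cdot\frac{1}{2+\alpha y^{\alpha}}.$$ Moreover, if $\alpha\in(0,1)$, then for every $y>0$, $$\mathbb{P}(X\ge y)\le\frac{4}{\alpha y^{\alpha}}.$$
   Context: The characteristic function above equals $\exp\left(\int_{\mathbb{R}}(e^{itx}-1)\frac{dx}{|x|^{\alpha+1}}\right)$ (integral in the symmetric principal-value sense), i.e. $X$ is symmetric strictly $\alpha$-stable with Lévy measure $|x|^{-\alpha-1}dx$. *)

theory Defs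
  imports "HOL-Probability.Probability"
begin

end

theory Submission
  imports Defs
begin

text \<open>Since the characteristic function is real, \<open>X\<close> is symmetric and
  \<open>P(X \<ge> y) = P(\<bar>X\<bar> \<ge> y) / 2\<close>.

  Upper bound: averaging \<open>1 - cos (t X)\<close> over \<open>0 \<le> t \<le> 2 / y\<close> bounds \<open>P(\<bar>X\<bar> \<ge> y)\<close> by an
  integral of \<open>1 - E cos (t X)\<close>, which is at most the characteristic exponent, and the latter is
  estimated by splitting its integral at \<open>2 / \<bar>t\<bar>\<close>.

  Lower bound: \<open>X\<close> is the weak limit of sums of \<open>n\<close> independent symmetric Pareto variables, each
  exceeding \<open>y\<close> in absolute value with probability \<open>\<nu> / n\<close>, where \<open>\<nu> = 2 / (\<alpha> y\<^sup>\<alpha>)\<close>. Levy's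
  inequality for symmetric summands shows that such a sum exceeds \<open>y\<close> in absolute value with
  probability at least \<open>(1 - (1 - \<nu> / n)\<^sup>n) / 2\<close>, which tends to
  \<open>(1 - e\<^sup>-\<^sup>\<nu>) / 2 \<ge> \<nu> / (2 (1 + \<nu>))\<close>.\<close>

subsection \<open>The characteristic exponent and the upper tail\<close>

lemma one_minus_cos_le: "1 - cos x \<le> x\<^sup>2 / 2" for x :: real
proof -
  have "cos x = 1 - 2 * (sin (x / 2))\<^sup>2"
    using cos_double_sin[of "x / 2"] by simp
  moreover have "(sin (x / 2))\<^sup>2 \<le> (x / 2)\<^sup>2"
    using abs_sin_x_le_abs_x[of "x / 2"] by (simp only: abs_le_square_iff)
  ultimately show ?thesis
    by (simp add: power2_eq_square)
qed

lemma has_bochner_integral_powr_from_0: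
  fixes a c :: real
  assumes "a > -1" "c \<ge> 0"
  shows "has_bochner_integral lborel (\<lambda>x. indicator {0..c} x * x powr a) (c powr (a + 1) / (a + 1))"
  using nn_integral_has_integral_lebesgue[OF _ has_integral_powr_from_0[OF assms]] assms
  by (intro has_bochner_integral_nn_integral) auto

lemma has_bochner_integral_powr_to_inf:
  fixes a e :: real
  assumes "e < -1" "a > 0"
  shows "has_bochner_integral lborel (\<lambda>x. indicator {a..} x * x powr e) (- (a powr (e + 1)) / (e + 1))"
  using nn_integral_has_integral_lebesgue[OF _ has_integral_powr_to_inf[OF assms]] assms
  by (intro has_bochner_integral_nn_integral) (auto simp: divide_nonneg_neg divide_nonpos_neg)

text \<open>Near 0 the bound 1 - cos u \<le> u^2 / 2 is integrable against the Levy density because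
  \<alpha> < 2; at infinity 1 - cos u \<le> 2 is, because \<alpha> > 0. Both pieces are explicit
  power integrals, and their values 2 / (2 - \<alpha>) and 2 / \<alpha>, times
  \<open>(\<bar>t\<bar> / 2) powr \<alpha>\<close>, add up to the bound.\<close>

lemma stable_exponent:
  fixes \<alpha> t :: real
  assumes \<alpha>: "0 < \<alpha>" "\<alpha> < 2"
  shows set_integrable_stable_exponent:
      "set_integrable lborel {0<..} (\<lambda>x. (1 - cos (t * x)) / x powr (\<alpha> + 1))"
    and stable_exponent_le:
      "(LBINT x:{0<..}. (1 - cos (t * x)) / x powr (\<alpha> + 1)) \<le> 4 * (\<bar>t\<bar> / 2) powr \<alpha> / (\<alpha> * (2 - \<alpha>))"
proof -
  let ?f = "\<lambda>x. indicator {0<..} x * ((1 - cos (t * x)) / x powr (\<alpha> + 1))"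
  have "integrable lborel ?f \<and> integral\<^sup>L lborel ?f \<le> 4 * (\<bar>t\<bar> / 2) powr \<alpha> / (\<alpha> * (2 - \<alpha>))"
  proof (cases "t = 0")
    case True
    then show ?thesis using \<alpha> by simp
  next
    case False
    \<comment> \<open>The two bounds (t x)^2 / 2 and 2 coincide at |t x| = 2.\<close>
    define a where "a = 2 / \<bar>t\<bar>"
    have a: "a > 0" using False by (simp add: a_def)
    \<comment> \<open>The indicators overlap at x = a, which is harmless for a majorant.\<close>
    define g where "g x = t\<^sup>2 / 2 * (indicator {0..a} x * x powr (1 - \<alpha>)) +
      2 * (indicator {a..} x * x powr (- \<alpha> - 1))" for x
    have "has_bochner_integral lborel g
      (t\<^sup>2 / 2 * (a powr (1 - \<alpha> + 1) / (1 - \<alpha> + 1)) + 2 * (- (a powr (- \<alpha> - 1 + 1)) / (- \<alpha> - 1 + 1)))"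
      unfolding g_def using \<alpha> a
      by (intro has_bochner_integral_add has_bochner_integral_mult_right
          has_bochner_integral_powr_from_0 has_bochner_integral_powr_to_inf) auto
    also have "t\<^sup>2 / 2 * (a powr (1 - \<alpha> + 1) / (1 - \<alpha> + 1)) + 2 * (- (a powr (- \<alpha> - 1 + 1)) / (- \<alpha> - 1 + 1))
        = 4 * (\<bar>t\<bar> / 2) powr \<alpha> / (\<alpha> * (2 - \<alpha>))"
    proof -
      have "a powr (1 - \<alpha> + 1) = a powr 2 * a powr (- \<alpha>)"
        by (simp add: powr_add[symmetric])
      also have "a powr 2 = 4 / t\<^sup>2"
        using a False by (simp add: a_def power_divide)
      finally have 1: "a powr (1 - \<alpha> + 1) = 4 / t\<^sup>2 * a powr (- \<alpha>)" .
      have 2: "a powr (- \<alpha>) = (\<bar>t\<bar> / 2) powr \<alpha>"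
        using False by (simp add: a_def powr_minus powr_divide)
      show ?thesis
        unfolding 1 using \<alpha> False by (simp add: 2 field_simps)
    qed
    finally have g: "has_bochner_integral lborel g (4 * (\<bar>t\<bar> / 2) powr \<alpha> / (\<alpha> * (2 - \<alpha>)))" .
    have le: "?f x \<le> g x" for x
    proof (cases "x > 0")
      case x: True
      show ?thesis
      proof (cases "x \<le> a")
        case True
        have "(1 - cos (t * x)) / x powr (\<alpha> + 1) \<le> (t * x)\<^sup>2 / 2 / x powr (\<alpha> + 1)"
          by (intro divide_right_mono one_minus_cos_le) auto
        also have "\<dots> = t\<^sup>2 / 2 * (x powr 2 / x powr (\<alpha> + 1))"
          using x by (simp add: power_mult_distrib)
        also have "\<dots> = t\<^sup>2 / 2 * x powr (1 - \<alpha>)"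
          by (subst powr_diff[symmetric]) (simp add: algebra_simps)
        finally have "(1 - cos (t * x)) / x powr (\<alpha> + 1) \<le> t\<^sup>2 / 2 * x powr (1 - \<alpha>)" .
        moreover have "0 \<le> indicator {a..} x * x powr (- \<alpha> - 1)" by simp
        ultimately have "(1 - cos (t * x)) / x powr (\<alpha> + 1) \<le> t\<^sup>2 / 2 * x powr (1 - \<alpha>) +
            2 * (indicator {a..} x * x powr (- \<alpha> - 1))" by linarith
        then show ?thesis using x True by (simp add: g_def)
      next
        case False
        have "(1 - cos (t * x)) / x powr (\<alpha> + 1) \<le> 2 / x powr (\<alpha> + 1)"
          using cos_ge_minus_one[of "t * x"] by (intro divide_right_mono) auto
        also have "\<dots> = 2 * x powr (- \<alpha> - 1)"
          using powr_minus_divide[of x "\<alpha> + 1"] by simp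
        finally show ?thesis using x False by (auto simp: g_def indicator_def)
      qed
    qed (auto simp: g_def indicator_def)
    have f0: "0 \<le> ?f x" for x by auto
    have "integrable lborel ?f"
      by (rule Bochner_Integration.integrable_bound[OF integrable.intros[OF g]])
        (use le f0 in \<open>auto simp: abs_of_nonneg intro!: AE_I2 order.trans[OF _ abs_ge_self]\<close>)
    moreover from this have "integral\<^sup>L lborel ?f \<le> integral\<^sup>L lborel g"
      by (intro integral_mono integrable.intros[OF g] le)
    ultimately show ?thesis
      using g by (simp add: has_bochner_integral_integral_eq)
  qed
  then show "set_integrable lborel {0<..} (\<lambda>x. (1 - cos (t * x)) / x powr (\<alpha> + 1))"
    and "(LBINT x:{0<..}. (1 - cos (t * x)) / x powr (\<alpha> + 1)) \<le> 4 * (\<bar>t\<bar> / 2) powr \<alpha> / (\<alpha> * (2 - \<alpha>))"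
    by (simp_all add: set_integrable_def set_lebesgue_integral_def)
qed

section \<open>Tail bounds from the characteristic function\<close>

text \<open>Integrating 1 - cos (t x) over 0 \<le> t \<le> 2 / y gives at least 1 / y whenever |x|
  \<ge> y; exchanging the integrals turns its expectation into an integral of 1 - Re (char). The
  majorant \<open>h\<close> allows an explicit power of t to be integrated instead.\<close>

lemma (in real_distribution) measure_abs_ge_le_char:
  assumes y: "y > 0"
    and I: "has_bochner_integral lborel (\<lambda>t. indicator {0..2 / y} t * h t) I"
    and h: "\<And>t. t \<in> {0..2 / y} \<Longrightarrow> 1 - Re (char M t) \<le> h t"
  shows "measure M {x. \<bar>x\<bar> \<ge> y} \<le> y * I"
proof -
  define u where "u = 2 / y"
  have u: "u > 0" using y by (simp add: u_def)
  define F where "F t x = indicator {0..u} t * (1 - cos (t * x))" for t x :: real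
  have F0: "F t x \<ge> 0" for t x by (simp add: F_def)
  have h0: "0 \<le> indicator {0..u} t * h t" for t
  proof (cases "t \<in> {0..u}")
    case True
    have "Re (char M t) \<le> 1"
      using cmod_char_le_1[of t] complex_Re_le_cmod[of "char M t"] by linarith
    then show ?thesis using h[of t] True by (auto simp: u_def)
  qed auto
  interpret P: pair_sigma_finite lborel M ..
  have [measurable]: "(\<lambda>(t, x). F t x) \<in> borel_measurable (lborel \<Otimes>\<^sub>M M)"
    unfolding F_def by measurable
  have "ennreal (measure M {x. \<bar>x\<bar> \<ge> y} / y) = (\<integral>\<^sup>+x. ennreal (1 / y) * indicator {x. \<bar>x\<bar> \<ge> y} x \<partial>M)"
    using y by (simp add: nn_integral_cmult_indicator emeasure_eq_measure ennreal_mult[symmetric])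
  also have "\<dots> \<le> (\<integral>\<^sup>+x. (\<integral>\<^sup>+t. F t x \<partial>lborel) \<partial>M)"
  proof (intro nn_integral_mono)
    fix x
    show "ennreal (1 / y) * indicator {x. \<bar>x\<bar> \<ge> y} x \<le> (\<integral>\<^sup>+t. F t x \<partial>lborel)"
    proof (cases "\<bar>x\<bar> \<ge> y")
      case True
      then have x: "x \<noteq> 0" using y by auto
      have "(\<integral>\<^sup>+t. F t x \<partial>lborel) = (\<integral>\<^sup>+t. ennreal (1 - cos (t * x)) * indicator {0..u} t \<partial>lborel)"
        by (intro nn_integral_cong) (auto simp: F_def indicator_def)
      also have "\<dots> = (u - sin (u * x) / x) - (0 - sin (0 * x) / x)"
        using x u by (intro nn_integral_FTC_Icc) (auto intro!: derivative_eq_intros)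
      finally have 1: "(\<integral>\<^sup>+t. F t x \<partial>lborel) = ennreal (u - sin (u * x) / x)" by simp
      \<comment> \<open>The upper limit 2 / y is chosen so that 1 / y remains after this loss of at
        most 1 / y.\<close>
      have "\<bar>sin (u * x) / x\<bar> \<le> 1 / y"
        using True y by (auto simp: abs_divide intro!: frac_le)
      then have "1 / y \<le> u - sin (u * x) / x"
        unfolding u_def abs_le_iff by argo
      then show ?thesis using True by (simp add: 1 ennreal_leI)
    qed auto
  qed
  also have "\<dots> = (\<integral>\<^sup>+t. (\<integral>\<^sup>+x. F t x \<partial>M) \<partial>lborel)"
    by (rule P.Fubini') measurable
  also have "\<dots> \<le> (\<integral>\<^sup>+t. ennreal (indicator {0..u} t * h t) \<partial>lborel)"
  proof (intro nn_integral_mono)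
    fix t
    have "F t x \<le> 2" for x
      using cos_ge_minus_one[of "t * x"] by (auto simp: F_def indicator_def)
    then have "(\<integral>\<^sup>+x. F t x \<partial>M) = ennreal (\<integral>x. F t x \<partial>M)"
      by (intro nn_integral_eq_integral integrable_const_bound[where B = 2])
        (auto simp: F0 abs_of_nonneg F_def[abs_def])
    also have "(\<integral>x. F t x \<partial>M) = indicator {0..u} t * (1 - Re (char M t))"
    proof -
      have i: "integrable M (\<lambda>x. iexp (t * x))"
        by (intro integrable_iexp) auto
      have "Re (char M t) = (\<integral>x. Re (iexp (t * x)) \<partial>M)"
        unfolding char_def using i by simp
      also have "\<dots> = (\<integral>x. cos (t * x) \<partial>M)" by (simp add: Re_exp)
      finally have "Re (char M t) = (\<integral>x. cos (t * x) \<partial>M)" .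
      moreover have "integrable M (\<lambda>x. cos (t * x))"
        by (intro integrable_const_bound[where B = 1]) auto
      ultimately show ?thesis
        by (simp add: F_def prob_space del: space_eq_univ)
    qed
    also have "ennreal \<dots> \<le> ennreal (indicator {0..u} t * h t)"
      using h[of t] by (auto simp: indicator_def u_def intro!: ennreal_leI)
    finally show "(\<integral>\<^sup>+x. F t x \<partial>M) \<le> ennreal (indicator {0..u} t * h t)" .
  qed
  also have "\<dots> = ennreal I"
    using I h0 by (subst nn_integral_eq_integral) (auto simp: u_def has_bochner_integral_iff)
  finally have "ennreal (measure M {x. \<bar>x\<bar> \<ge> y} / y) \<le> ennreal I" .
  moreover have "I \<ge> 0"
    using I h0 by (auto simp: u_def has_bochner_integral_iff intro!: integral_nonneg)
  ultimately show ?thesis using y by (simp add: field_simps)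
qed

text \<open>By 1 - exp (- s) \<le> s and the bound on the exponent, 1 - Re (char) is at most
  \<open>K * t powr \<alpha>\<close>, whose integral over [0, 2 / y] is explicit. The range of
  \<alpha> is still all of (0, 2) here.\<close>

lemma (in real_distribution) stable_measure_abs_ge_le:
  assumes \<alpha>: "0 < \<alpha>" "\<alpha> < 2" and y: "y > 0"
    and char: "\<And>t. char M t =
      complex_of_real (exp (- 2 * (LBINT x:{0<..}. (1 - cos (t * x)) / x powr (\<alpha> + 1))))"
  shows "measure M {x. \<bar>x\<bar> \<ge> y} \<le> 16 / (\<alpha> * (2 - \<alpha>) * (\<alpha> + 1) * y powr \<alpha>)"
proof -
  define K where "K = 8 / (\<alpha> * (2 - \<alpha>)) * (1 / 2) powr \<alpha>"
  have "has_bochner_integral lborel (\<lambda>t. K * (indicator {0..2 / y} t * t powr \<alpha>))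
      (K * ((2 / y) powr (\<alpha> + 1) / (\<alpha> + 1)))"
    using \<alpha> y by (intro has_bochner_integral_mult_right has_bochner_integral_powr_from_0) auto
  then have "has_bochner_integral lborel (\<lambda>t. indicator {0..2 / y} t * (K * t powr \<alpha>))
      (K * ((2 / y) powr (\<alpha> + 1) / (\<alpha> + 1)))"
    by (simp add: mult_ac)
  then have "measure M {x. \<bar>x\<bar> \<ge> y} \<le> y * (K * ((2 / y) powr (\<alpha> + 1) / (\<alpha> + 1)))"
  proof (rule measure_abs_ge_le_char[OF y])
    fix t assume t: "t \<in> {0..2 / y}"
    let ?\<psi> = "LBINT x:{0<..}. (1 - cos (t * x)) / x powr (\<alpha> + 1)"
    have "1 - Re (char M t) \<le> 2 * ?\<psi>"
      using exp_ge_add_one_self[of "- 2 * ?\<psi>"] unfolding char by simp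
    also have "\<dots> \<le> 2 * (4 * (\<bar>t\<bar> / 2) powr \<alpha> / (\<alpha> * (2 - \<alpha>)))"
      by (intro mult_left_mono stable_exponent_le \<alpha>) auto
    also have "\<dots> = K * t powr \<alpha>"
      using t by (simp add: K_def powr_divide)
    finally show "1 - Re (char M t) \<le> K * t powr \<alpha>" .
  qed
  also have "\<dots> = 16 / (\<alpha> * (2 - \<alpha>) * (\<alpha> + 1) * y powr \<alpha>)"
    using \<alpha> y by (simp add: K_def powr_add powr_divide)
  finally show ?thesis .
qed

subsection \<open>Symmetric Pareto distributions\<close>

text \<open>For \<open>\<epsilon> > 0\<close>, \<open>sym_pareto \<alpha> \<epsilon>\<close> is the Levy measure \<open>\<bar>x\<bar> powr (- \<alpha> - 1) dx\<close> restricted to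
  \<open>\<bar>x\<bar> \<ge> \<epsilon>\<close> and normalised to total mass 1.\<close>
definition sym_pareto_density :: "real \<Rightarrow> real \<Rightarrow> real \<Rightarrow> real" where
  "sym_pareto_density \<alpha> \<epsilon> x = \<alpha> / 2 * \<epsilon> powr \<alpha> * (indicator {\<epsilon>..} \<bar>x\<bar> * \<bar>x\<bar> powr (- \<alpha> - 1))"

definition sym_pareto :: "real \<Rightarrow> real \<Rightarrow> real measure" where
  "sym_pareto \<alpha> \<epsilon> = density lborel (\<lambda>x. ennreal (sym_pareto_density \<alpha> \<epsilon> x))"

lemma sym_pareto_density_measurable [measurable]:
  "sym_pareto_density \<alpha> \<epsilon> \<in> borel_measurable borel"
  unfolding sym_pareto_density_def by measurable

lemma sym_pareto_density_nonneg: "0 \<le> \<alpha> \<Longrightarrow> 0 \<le> sym_pareto_density \<alpha> \<epsilon> x"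
  by (simp add: sym_pareto_density_def)

lemma sym_pareto_density_minus [simp]: "sym_pareto_density \<alpha> \<epsilon> (- x) = sym_pareto_density \<alpha> \<epsilon> x"
  by (simp add: sym_pareto_density_def)

lemma sets_sym_pareto [simp, measurable_cong]: "sets (sym_pareto \<alpha> \<epsilon>) = sets borel"
  by (simp add: sym_pareto_def)

text \<open>Half of the Pareto tail lies on each side, so evenness doubles this value to the
  two-sided tail; r = \<epsilon> gives the total mass.\<close>

lemma has_bochner_integral_sym_pareto_density_half:
  assumes "0 < \<alpha>" "0 < \<epsilon>" "\<epsilon> \<le> r"
  shows "has_bochner_integral lborel
    (\<lambda>x. indicator {0..} x *\<^sub>R (indicator {r..} \<bar>x\<bar> * sym_pareto_density \<alpha> \<epsilon> x)) ((\<epsilon> / r) powr \<alpha> / 2)"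
proof -
  have "has_bochner_integral lborel (\<lambda>x. \<alpha> / 2 * \<epsilon> powr \<alpha> * (indicator {r..} x * x powr (- \<alpha> - 1)))
      (\<alpha> / 2 * \<epsilon> powr \<alpha> * (- (r powr (- \<alpha> - 1 + 1)) / (- \<alpha> - 1 + 1)))"
    using assms by (intro has_bochner_integral_mult_right has_bochner_integral_powr_to_inf) auto
  also have "(\<lambda>x. \<alpha> / 2 * \<epsilon> powr \<alpha> * (indicator {r..} x * x powr (- \<alpha> - 1))) =
      (\<lambda>x. indicator {0..} x *\<^sub>R (indicator {r..} \<bar>x\<bar> * sym_pareto_density \<alpha> \<epsilon> x))"
    using assms by (auto simp: sym_pareto_density_def indicator_def fun_eq_iff)
  also have "\<alpha> / 2 * \<epsilon> powr \<alpha> * (- (r powr (- \<alpha> - 1 + 1)) / (- \<alpha> - 1 + 1)) = (\<epsilon> / r) powr \<alpha> / 2"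
    using assms by (simp add: powr_divide powr_minus field_simps)
  finally show ?thesis .
qed

lemma emeasure_sym_pareto_abs_ge:
  assumes "0 < \<alpha>" "0 < \<epsilon>" "\<epsilon> \<le> r"
  shows "emeasure (sym_pareto \<alpha> \<epsilon>) {x. \<bar>x\<bar> \<ge> r} = ennreal ((\<epsilon> / r) powr \<alpha>)"
proof -
  have i: "has_bochner_integral lborel (\<lambda>x. indicator {r..} \<bar>x\<bar> * sym_pareto_density \<alpha> \<epsilon> x)
      (2 *\<^sub>R ((\<epsilon> / r) powr \<alpha> / 2))"
    using has_bochner_integral_sym_pareto_density_half[OF assms]
    by (rule has_bochner_integral_even_function) simp
  have "emeasure (sym_pareto \<alpha> \<epsilon>) {x. \<bar>x\<bar> \<ge> r} =
      (\<integral>\<^sup>+x. ennreal (indicator {r..} \<bar>x\<bar> * sym_pareto_density \<alpha> \<epsilon> x) \<partial>lborel)"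
    unfolding sym_pareto_def
    by (subst emeasure_density) (auto simp: indicator_def intro!: nn_integral_cong)
  also have "\<dots> = ennreal ((\<epsilon> / r) powr \<alpha>)"
    using i assms sym_pareto_density_nonneg[of \<alpha> \<epsilon>]
    by (subst nn_integral_eq_integral) (auto simp: has_bochner_integral_iff)
  finally show ?thesis .
qed

lemma real_distribution_sym_pareto:
  assumes "0 < \<alpha>" "0 < \<epsilon>"
  shows "real_distribution (sym_pareto \<alpha> \<epsilon>)"
proof -
  have "emeasure (sym_pareto \<alpha> \<epsilon>) (space (sym_pareto \<alpha> \<epsilon>)) =
      (\<integral>\<^sup>+x. ennreal (sym_pareto_density \<alpha> \<epsilon> x) \<partial>lborel)"
    by (simp add: sym_pareto_def emeasure_density)
  \<comment> \<open>The density vanishes for |x| < \<epsilon>, so the total mass is the tail at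
    \<epsilon>.\<close>
  also have "\<dots> = emeasure (sym_pareto \<alpha> \<epsilon>) {x. \<bar>x\<bar> \<ge> \<epsilon>}"
    unfolding sym_pareto_def
    by (subst emeasure_density)
      (auto simp: indicator_def sym_pareto_density_def intro!: nn_integral_cong)
  also have "\<dots> = 1"
    using emeasure_sym_pareto_abs_ge[OF assms order_refl] assms by simp
  finally show ?thesis
    unfolding real_distribution_def real_distribution_axioms_def by (auto intro: prob_spaceI)
qed

text \<open>Both Lebesgue measure and the density are invariant under reflection. This supplies the
  symmetry required for flipping a summand.\<close>

lemma distr_uminus_sym_pareto: "distr (sym_pareto \<alpha> \<epsilon>) borel uminus = sym_pareto \<alpha> \<epsilon>"
proof -
  have "sym_pareto \<alpha> \<epsilon> = density (distr lborel borel uminus) (\<lambda>x. ennreal (sym_pareto_density \<alpha> \<epsilon> x))"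
    by (simp add: sym_pareto_def lborel_distr_uminus)
  also have "\<dots> = distr (sym_pareto \<alpha> \<epsilon>) borel uminus"
    by (subst density_distr) (auto simp: sym_pareto_def)
  finally show ?thesis by simp
qed

text \<open>The sine part is odd and integrates to 0. In the cosine part, cos = 1 - (1 - cos) splits
  off the total mass 1 and leaves the exponent truncated at \<epsilon>.\<close>

lemma char_sym_pareto:
  assumes \<alpha>: "0 < \<alpha>" "\<alpha> < 2" and \<epsilon>: "0 < \<epsilon>"
  shows "char (sym_pareto \<alpha> \<epsilon>) t =
    complex_of_real (1 - \<alpha> * \<epsilon> powr \<alpha> * (LBINT x:{\<epsilon>..}. (1 - cos (t * x)) / x powr (\<alpha> + 1)))"
proof -
  let ?d = "sym_pareto_density \<alpha> \<epsilon>"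
  let ?\<Psi> = "LBINT x:{\<epsilon>..}. (1 - cos (t * x)) / x powr (\<alpha> + 1)"
  have half: "has_bochner_integral lborel (\<lambda>x. indicator {0..} x *\<^sub>R ?d x) (1 / 2)"
  proof -
    have "indicator {\<epsilon>..} \<bar>x\<bar> * ?d x = ?d x" for x
      by (simp add: sym_pareto_density_def indicator_def)
    then have "(\<lambda>x. indicator {0..} x *\<^sub>R (indicator {\<epsilon>..} \<bar>x\<bar> * ?d x)) = (\<lambda>x. indicator {0..} x *\<^sub>R ?d x)"
      by presburger
    then show ?thesis
      using has_bochner_integral_sym_pareto_density_half[OF \<alpha>(1) \<epsilon> order_refl] \<epsilon> by simp
  qed
  have "set_integrable lborel {\<epsilon>..} (\<lambda>x. (1 - cos (t * x)) / x powr (\<alpha> + 1))"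
    by (rule set_integrable_subset[OF set_integrable_stable_exponent[OF \<alpha>]]) (use \<epsilon> in auto)
  then have "has_bochner_integral lborel
      (\<lambda>x. indicator {\<epsilon>..} x *\<^sub>R ((1 - cos (t * x)) / x powr (\<alpha> + 1))) ?\<Psi>"
    unfolding set_integrable_def set_lebesgue_integral_def by (rule has_bochner_integral_integrable)
  then have "has_bochner_integral lborel (\<lambda>x. indicator {0..} x *\<^sub>R ?d x - \<alpha> / 2 * \<epsilon> powr \<alpha> *
      (indicator {\<epsilon>..} x *\<^sub>R ((1 - cos (t * x)) / x powr (\<alpha> + 1)))) (1 / 2 - \<alpha> / 2 * \<epsilon> powr \<alpha> * ?\<Psi>)"
    by (intro has_bochner_integral_diff half has_bochner_integral_mult_right)
  also have "(\<lambda>x. indicator {0..} x *\<^sub>R ?d x - \<alpha> / 2 * \<epsilon> powr \<alpha> *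
      (indicator {\<epsilon>..} x *\<^sub>R ((1 - cos (t * x)) / x powr (\<alpha> + 1)))) =
      (\<lambda>x. indicator {0..} x *\<^sub>R (?d x * cos (t * x)))"
  proof
    fix x
    have "x powr (- \<alpha> - 1) = 1 / x powr (\<alpha> + 1)"
      using powr_minus_divide[of x "\<alpha> + 1"] by simp
    then show "indicator {0..} x *\<^sub>R ?d x - \<alpha> / 2 * \<epsilon> powr \<alpha> *
      (indicator {\<epsilon>..} x *\<^sub>R ((1 - cos (t * x)) / x powr (\<alpha> + 1))) =
      indicator {0..} x *\<^sub>R (?d x * cos (t * x))"
      using \<epsilon> by (auto simp: indicator_def sym_pareto_density_def algebra_simps diff_divide_distrib)
  qed
  finally have "has_bochner_integral lborel (\<lambda>x. ?d x * cos (t * x))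
      (2 *\<^sub>R (1 / 2 - \<alpha> / 2 * \<epsilon> powr \<alpha> * ?\<Psi>))"
    by (rule has_bochner_integral_even_function) simp
  then have cos: "has_bochner_integral lborel (\<lambda>x. ?d x * cos (t * x)) (1 - \<alpha> * \<epsilon> powr \<alpha> * ?\<Psi>)"
    by (simp add: algebra_simps)
  \<comment> \<open>Dominated by the density, since |sin| \<le> 1; integrability on the half-line
    suffices for the rule on odd functions.\<close>
  have "integrable lborel (\<lambda>x. indicator {0..} x *\<^sub>R (?d x * sin (t * x)))"
    by (rule Bochner_Integration.integrable_bound[OF integrable.intros[OF half]])
      (auto simp: abs_mult indicator_def mult_left_le intro!: AE_I2)
  then have sin: "has_bochner_integral lborel (\<lambda>x. ?d x * sin (t * x)) 0"
    by (intro has_bochner_integral_odd_function[OF has_bochner_integral_integrable]) auto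
  have "has_bochner_integral lborel (\<lambda>x. complex_of_real (?d x * cos (t * x)) + \<i> * complex_of_real (?d x * sin (t * x)))
      (complex_of_real (1 - \<alpha> * \<epsilon> powr \<alpha> * ?\<Psi>) + \<i> * complex_of_real 0)"
    by (intro has_bochner_integral_add has_bochner_integral_mult_right has_bochner_integral_of_real cos sin)
  also have "(\<lambda>x. complex_of_real (?d x * cos (t * x)) + \<i> * complex_of_real (?d x * sin (t * x))) =
      (\<lambda>x. ?d x *\<^sub>R iexp (t * x))"
    by (auto simp: fun_eq_iff complex_eq_iff Re_exp Im_exp)
  finally have "(CLBINT x. ?d x *\<^sub>R iexp (t * x)) = complex_of_real (1 - \<alpha> * \<epsilon> powr \<alpha> * ?\<Psi>)"
    by (simp add: has_bochner_integral_iff)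
  then show ?thesis
    unfolding char_def sym_pareto_def
    using \<alpha> by (subst integral_density) (auto simp: sym_pareto_density_nonneg)
qed

subsection \<open>Sums of independent symmetric variables\<close>

text \<open>The law of a sum of n independent copies. The recursion on laws avoids building a
  probability space for the n variables, and it exposes the last summand for induction.\<close>

primrec convolution_power :: "real measure \<Rightarrow> nat \<Rightarrow> real measure" where
  "convolution_power M 0 = return borel 0"
| "convolution_power M (Suc n) = convolution (convolution_power M n) M"

lemma real_distribution_convolution:
  assumes "real_distribution M" "real_distribution N"
  shows "real_distribution (convolution M N)"
proof -
  interpret M: real_distribution M by fact
  interpret N: real_distribution N by fact
  interpret P: pair_prob_space M N ..
  have "prob_space (convolution M N)"
    unfolding convolution_def by (intro P.prob_space_distr) measurable
  then show ?thesis
    by (simp add: real_distribution_def real_distribution_axioms_def)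
qed

text \<open>The convolution is the law of the sum of the two coordinates under the product measure,
  where they are independent with marginals M and N.\<close>

lemma char_convolution:
  assumes "real_distribution M" "real_distribution N"
  shows "char (convolution M N) t = char M t * char N t"
proof -
  interpret M: real_distribution M by fact
  interpret N: real_distribution N by fact
  interpret P: pair_prob_space M N ..
  have fst: "distr (M \<Otimes>\<^sub>M N) borel fst = M"
    using N.distr_pair_fst[of M] by (simp cong: distr_cong)
  have snd: "distr (M \<Otimes>\<^sub>M N) borel snd = N"
  proof (rule measure_eqI)
    fix A assume "A \<in> sets (distr (M \<Otimes>\<^sub>M N) borel snd)"
    then have A: "A \<in> sets borel" by simp
    have "emeasure (distr (M \<Otimes>\<^sub>M N) borel snd) A = emeasure (M \<Otimes>\<^sub>M N) (UNIV \<times> A)"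
      using A by (subst emeasure_distr) (auto simp: space_pair_measure intro!: arg_cong2[where f = emeasure])
    also have "\<dots> = emeasure N A"
      using A by (subst N.emeasure_pair_measure_Times) (auto simp: M.emeasure_space_1[simplified])
    finally show "emeasure (distr (M \<Otimes>\<^sub>M N) borel snd) A = emeasure N A" .
  qed simp
  have "P.indep_var borel fst borel snd"
    unfolding P.indep_var_distribution_eq fst snd
    by (auto simp: distr_id2 cong: distr_cong)
  from P.char_distr_add[OF this, of t] show ?thesis
    by (simp add: fst snd convolution_def split_beta')
qed

lemma real_distribution_convolution_power:
  assumes "real_distribution M"
  shows "real_distribution (convolution_power M n)"
proof (induction n)
  case 0
  show ?case
    by (simp add: real_distribution_def real_distribution_axioms_def prob_space_return)
qed (simp add: real_distribution_convolution assms)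

lemma char_convolution_power:
  assumes "real_distribution M"
  shows "char (convolution_power M n) t = char M t ^ n"
proof (induction n)
  case 0
  show ?case by (simp add: char_def integral_return)
qed (simp add: char_convolution real_distribution_convolution_power assms)

section \<open>Levy's inequality for symmetric summands\<close>

text \<open>Since 2 |x| \<le> |v + x| + |v - x|, one of the two signs of x keeps the sum at least
  |x| in absolute value. Hence the event |x| \<ge> y is covered by the event on the right and its
  reflection, which are equally likely.\<close>

lemma measure_symmetric_abs_add_ge:
  assumes "real_distribution M" and sym: "distr M borel uminus = M"
  shows "measure M {x. \<bar>x\<bar> \<ge> y} / 2 \<le> measure M {x. \<bar>x\<bar> \<ge> y \<and> \<bar>x + v\<bar> \<ge> y}"
proof -
  interpret real_distribution M by fact
  let ?A = "{x. \<bar>x\<bar> \<ge> y \<and> \<bar>x + v\<bar> \<ge> y}"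
  have "measure M ?A = measure (distr M borel uminus) ?A" by (simp add: sym)
  also have "\<dots> = measure M (uminus -` ?A)"
    by (subst measure_distr) (auto simp: measurable_sets)
  finally have eq: "measure M (uminus -` ?A) = measure M ?A" by simp
  have "measure M {x. \<bar>x\<bar> \<ge> y} \<le> measure M (?A \<union> uminus -` ?A)"
    by (intro finite_measure_mono) (auto simp: measurable_sets_borel)
  also have "\<dots> \<le> measure M ?A + measure M (uminus -` ?A)"
    by (intro measure_Un_le) (auto simp: measurable_sets_borel)
  finally show ?thesis unfolding eq by linarith
qed

text \<open>Levy's maximal inequality without the maximum: whether the last summand exceeds \<open>y\<close> in
  absolute value decides between flipping its sign and the induction hypothesis, and the latter
  absorbs a small summand into the shift \<open>w\<close>.\<close>
lemma measure_convolution_power_abs_ge: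
  assumes M: "real_distribution M" and sym: "distr M borel uminus = M"
  shows "(1 - (1 - measure M {x. \<bar>x\<bar> \<ge> y}) ^ n) / 2 \<le> measure (convolution_power M n) {x. \<bar>x + w\<bar> \<ge> y}"
proof (induction n arbitrary: w)
  case (Suc n)
  define N where "N = convolution_power M n"
  define q where "q = measure M {x. \<bar>x\<bar> \<ge> y}"
  define b where "b = (1 - (1 - q) ^ n) / 2"
  interpret M: real_distribution M by fact
  interpret N: real_distribution N
    unfolding N_def by (rule real_distribution_convolution_power[OF M])
  interpret NM: real_distribution "convolution N M"
    by (intro real_distribution_convolution M N.real_distribution_axioms)
  interpret P: pair_sigma_finite N M ..
  have q: "0 \<le> q" "q \<le> 1" by (simp_all add: q_def)
  have b: "0 \<le> b" using q by (simp add: b_def power_le_one)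
  have IH: "b \<le> measure N {x. \<bar>x + v\<bar> \<ge> y}" for v
    using Suc by (simp add: b_def q_def N_def)
  define A where "A = {x. \<bar>x + w\<bar> \<ge> y}"
  have [measurable]: "A \<in> sets borel" by (simp add: A_def)
  \<comment> \<open>Here x is the sum of the first n variables and z is the last one.\<close>
  let ?big = "\<lambda>x z. indicator {z. \<bar>z\<bar> \<ge> y} z * indicator A (x + z) :: ennreal"
  let ?small = "\<lambda>x z. indicator {z. \<bar>z\<bar> < y} z * indicator A (x + z) :: ennreal"
  have "ennreal (q / 2) = (\<integral>\<^sup>+x. ennreal (q / 2) \<partial>N)"
    by (simp add: N.emeasure_space_1 del: N.space_eq_univ)
  also have "\<dots> \<le> (\<integral>\<^sup>+x. \<integral>\<^sup>+z. ?big x z \<partial>M \<partial>N)"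
  proof (intro nn_integral_mono)
    fix x
    have "ennreal (q / 2) \<le> emeasure M {z. \<bar>z\<bar> \<ge> y \<and> \<bar>z + (x + w)\<bar> \<ge> y}"
      using measure_symmetric_abs_add_ge[OF M sym, of y "x + w"]
      by (simp add: M.emeasure_eq_measure q_def ennreal_leI)
    also have "\<dots> = (\<integral>\<^sup>+z. indicator {z. \<bar>z\<bar> \<ge> y \<and> \<bar>z + (x + w)\<bar> \<ge> y} z \<partial>M)"
      by simp
    also have "\<dots> = (\<integral>\<^sup>+z. ?big x z \<partial>M)"
      by (intro nn_integral_cong) (auto simp: indicator_def A_def algebra_simps)
    finally show "ennreal (q / 2) \<le> (\<integral>\<^sup>+z. ?big x z \<partial>M)" .
  qed
  finally have big: "ennreal (q / 2) \<le> (\<integral>\<^sup>+x. \<integral>\<^sup>+z. ?big x z \<partial>M \<partial>N)" .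
  have "measure M (space M - {x. \<bar>x\<bar> \<ge> y}) = 1 - q"
    unfolding q_def by (intro M.prob_compl) simp
  also have "space M - {x. \<bar>x\<bar> \<ge> y} = {x. \<bar>x\<bar> < y}" by auto
  finally have "ennreal (b * (1 - q)) = ennreal b * emeasure M {x. \<bar>x\<bar> < y}"
    using b q by (simp add: M.emeasure_eq_measure ennreal_mult)
  also have "\<dots> = (\<integral>\<^sup>+z. ennreal b * indicator {x. \<bar>x\<bar> < y} z \<partial>M)"
    by (simp add: nn_integral_cmult_indicator)
  \<comment> \<open>With z fixed, the induction hypothesis applies to x with shift z + w; this order
    of integration is the reverse of the one in \<open>big\<close>, hence the exchange that
    follows.\<close>
  also have "\<dots> \<le> (\<integral>\<^sup>+z. \<integral>\<^sup>+x. ?small x z \<partial>N \<partial>M)"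
  proof (intro nn_integral_mono)
    fix z
    have "ennreal b \<le> emeasure N {x. \<bar>x + (z + w)\<bar> \<ge> y}"
      using IH[of "z + w"] by (simp add: N.emeasure_eq_measure ennreal_leI)
    also have "\<dots> = (\<integral>\<^sup>+x. indicator {x. \<bar>x + (z + w)\<bar> \<ge> y} x \<partial>N)"
      by simp
    also have "\<dots> = (\<integral>\<^sup>+x. ?small x z \<partial>N)" if "\<bar>z\<bar> < y"
      using that by (intro nn_integral_cong) (auto simp: indicator_def A_def algebra_simps)
    finally show "ennreal b * indicator {x. \<bar>x\<bar> < y} z \<le> (\<integral>\<^sup>+x. ?small x z \<partial>N)"
      by (auto simp: indicator_def)
  qed
  also have "\<dots> = (\<integral>\<^sup>+x. \<integral>\<^sup>+z. ?small x z \<partial>M \<partial>N)"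
    by (rule P.Fubini') measurable
  finally have small: "ennreal (b * (1 - q)) \<le> (\<integral>\<^sup>+x. \<integral>\<^sup>+z. ?small x z \<partial>M \<partial>N)" .
  \<comment> \<open>The claimed bound is exactly the solution, starting from 0, of this recursion: a
    large last summand contributes q / 2, a small one (1 - q) times the previous bound.\<close>
  have "(1 - (1 - q) ^ Suc n) / 2 = q / 2 + b * (1 - q)"
    by (simp add: b_def field_simps)
  then have "ennreal ((1 - (1 - q) ^ Suc n) / 2) = ennreal (q / 2) + ennreal (b * (1 - q))"
    using q b
    by (simp only: ennreal_plus[symmetric] divide_nonneg_nonneg mult_nonneg_nonneg
        diff_ge_0_iff_ge zero_le_numeral)
  also have "\<dots> \<le> (\<integral>\<^sup>+x. \<integral>\<^sup>+z. ?big x z \<partial>M \<partial>N) + (\<integral>\<^sup>+x. \<integral>\<^sup>+z. ?small x z \<partial>M \<partial>N)"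
    by (intro add_mono big small)
  also have "\<dots> = (\<integral>\<^sup>+x. \<integral>\<^sup>+z. ?big x z + ?small x z \<partial>M \<partial>N)"
  proof -
    have "(\<integral>\<^sup>+z. ?big x z + ?small x z \<partial>M) = (\<integral>\<^sup>+z. ?big x z \<partial>M) + (\<integral>\<^sup>+z. ?small x z \<partial>M)" for x
      by (intro nn_integral_add) measurable
    then show ?thesis
      by (simp only:) (intro nn_integral_add[symmetric]; measurable)
  qed
  also have "\<dots> = (\<integral>\<^sup>+x. \<integral>\<^sup>+z. indicator A (x + z) \<partial>M \<partial>N)"
    by (intro nn_integral_cong) (auto simp: indicator_def)
  also have "\<dots> = emeasure (convolution N M) A"
    by (subst convolution_emeasure') (auto simp: M.finite_measure_axioms N.finite_measure_axioms)
  also have "\<dots> = ennreal (measure (convolution N M) A)"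
    by (simp add: NM.emeasure_eq_measure)
  finally show ?case
    by (simp add: q_def N_def A_def del: power_Suc)
qed simp

subsection \<open>Weak approximation and the lower tail\<close>

text \<open>Dominated convergence with |f| on the positive half-line: each x > 0 eventually exceeds
  the cutoff, and x \<le> 0 never contributes.\<close>

lemma tendsto_set_integral_atLeast_0:
  fixes f :: "real \<Rightarrow> real" and \<epsilon> :: "nat \<Rightarrow> real"
  assumes f: "set_integrable lborel {0<..} f" and \<epsilon>: "\<epsilon> \<longlonglongrightarrow> 0" "\<And>n. \<epsilon> n > 0"
  shows "(\<lambda>n. LBINT x:{\<epsilon> n..}. f x) \<longlonglongrightarrow> (LBINT x:{0<..}. f x)"
  unfolding set_lebesgue_integral_def
proof (rule integral_dominated_convergence[where w = "\<lambda>x. norm (indicator {0<..} x *\<^sub>R f x)"])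
  show "(\<lambda>x. indicator {0<..} x *\<^sub>R f x) \<in> borel_measurable lborel"
    using f by (auto simp: set_integrable_def)
  show "(\<lambda>x. indicator {\<epsilon> n..} x *\<^sub>R f x) \<in> borel_measurable lborel" for n
    using set_integrable_subset[OF f, of "{\<epsilon> n..}"] \<epsilon>(2)[of n] by (auto simp: set_integrable_def subset_eq)
  show "integrable lborel (\<lambda>x. norm (indicator {0<..} x *\<^sub>R f x))"
    using f unfolding set_integrable_def by (rule integrable_norm)
  show "AE x in lborel. (\<lambda>n. indicator {\<epsilon> n..} x *\<^sub>R f x) \<longlonglongrightarrow> indicator {0<..} x *\<^sub>R f x"
  proof (rule AE_I2)
    fix x :: real
    have "eventually (\<lambda>n. indicator {\<epsilon> n..} x *\<^sub>R f x = indicator {0<..} x *\<^sub>R f x) sequentially"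
    proof (cases "x > 0")
      case True
      then have "eventually (\<lambda>n. \<epsilon> n < x) sequentially" using order_tendstoD(2)[OF \<epsilon>(1)] by simp
      then show ?thesis by eventually_elim (use True in simp)
    next
      case False
      then have "\<not> \<epsilon> n \<le> x" for n using \<epsilon>(2)[of n] by linarith
      then show ?thesis using False by simp
    qed
    then show "(\<lambda>n. indicator {\<epsilon> n..} x *\<^sub>R f x) \<longlonglongrightarrow> indicator {0<..} x *\<^sub>R f x"
      by (rule tendsto_eventually)
  qed
  show "AE x in lborel. norm (indicator {\<epsilon> n..} x *\<^sub>R f x) \<le> norm (indicator {0<..} x *\<^sub>R f x)" for n
    using \<epsilon>(2)[of n] by (intro AE_I2) (auto simp: indicator_def)
qed

text \<open>Comparison with the constant sequence l: for bases of norm at most 1, the n-th powers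
  differ by at most n times the difference of the bases, here |a n - l|.\<close>

lemma tendsto_one_minus_div_power:
  fixes a :: "nat \<Rightarrow> real"
  assumes a: "a \<longlonglongrightarrow> l" and a0: "\<And>n. a n \<ge> 0"
  shows "(\<lambda>n. (1 - a n / n) ^ n) \<longlonglongrightarrow> exp (- l)"
proof -
  have l: "l \<ge> 0" using a a0 by (intro LIMSEQ_le_const) auto
  have lim: "(\<lambda>n. (1 - l / n) ^ n) \<longlonglongrightarrow> exp (- l)"
    using tendsto_exp_limit_sequentially[of "- l"] by simp
  have "eventually (\<lambda>n. a n < l + 1) sequentially"
    using a by (rule order_tendstoD(2)) simp
  then have "eventually (\<lambda>n. norm ((1 - a n / n) ^ n - (1 - l / n) ^ n) \<le> \<bar>a n - l\<bar>) sequentially"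
    using eventually_ge_at_top[of "nat \<lceil>l + 1\<rceil>"]
  proof eventually_elim
    case (elim n)
    \<comment> \<open>From a n < l + 1 \<le> n and l \<le> n, both bases lie in [0, 1].\<close>
    then have n: "l + 1 \<le> n" "n > 0" using l by linarith+
    have "norm ((1 - a n / n) ^ n - (1 - l / n) ^ n) \<le> n * norm ((1 - a n / n) - (1 - l / n))"
      using n l elim a0[of n] by (intro norm_power_diff) (auto simp: abs_le_iff field_simps)
    also have "\<dots> = \<bar>real n * ((1 - a n / n) - (1 - l / n))\<bar>"
      by (simp add: abs_mult)
    also have "real n * ((1 - a n / n) - (1 - l / n)) = l - a n"
      using n by (simp add: field_simps)
    finally show ?case by (simp add: abs_minus_commute)
  qed
  moreover have "(\<lambda>n. \<bar>a n - l\<bar>) \<longlonglongrightarrow> 0"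
    using tendsto_rabs[OF tendsto_diff[OF a tendsto_const[of l]]] by simp
  ultimately have "(\<lambda>n. (1 - a n / n) ^ n - (1 - l / n) ^ n) \<longlonglongrightarrow> 0"
    by (rule Lim_null_comparison)
  from Lim_transform[OF lim this] show ?thesis by simp
qed

text \<open>A form of 1 + s \<le> exp s; it turns the exponential limit into the rational lower
  bound.\<close>

lemma one_minus_exp_ge: "s / (1 + s) \<le> 1 - exp (- s)" if "s \<ge> 0" for s :: real
proof -
  have "exp (- s) \<le> 1 / (1 + s)"
    using that exp_ge_add_one_self[of s] by (simp add: exp_minus field_simps)
  then show ?thesis using that by (simp add: field_simps)
qed

section \<open>The lower tail bound by weak approximation\<close>

lemma stable_measure_abs_ge_ge:
  assumes M: "real_distribution M" and \<alpha>: "0 < \<alpha>" "\<alpha> < 2" and y: "y > 0"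
    and char: "\<And>t. char M t =
      complex_of_real (exp (- 2 * (LBINT x:{0<..}. (1 - cos (t * x)) / x powr (\<alpha> + 1))))"
  shows "1 / (2 + \<alpha> * y powr \<alpha>) \<le> measure M {x. \<bar>x\<bar> \<ge> y}"
proof -
  interpret M: real_distribution M by fact
  \<comment> \<open>Chosen so that \<alpha> times \<open>\<epsilon> n powr \<alpha>\<close> is 2 /
    (n + 1), which makes the characteristic function of \<open>S n\<close> the (n + 1)-th power of 1
    - 2 \<Psi> / (n + 1), with \<Psi> the truncated exponent. The successor keeps the cutoff
    positive at n = 0.\<close>
  define \<epsilon> where "\<epsilon> n = (2 / (\<alpha> * real (Suc n))) powr (1 / \<alpha>)" for n
  define S where "S n = convolution_power (sym_pareto \<alpha> (\<epsilon> n)) (Suc n)" for n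
  have \<epsilon>: "\<epsilon> n > 0" "\<epsilon> n powr \<alpha> = 2 / (\<alpha> * real (Suc n))" for n
    using \<alpha> by (simp_all add: \<epsilon>_def powr_powr del: of_nat_Suc)
  have lim\<epsilon>: "\<epsilon> \<longlonglongrightarrow> 0"
  proof -
    have "(\<lambda>n. 2 / \<alpha> * inverse (real (Suc n))) \<longlonglongrightarrow> 2 / \<alpha> * 0"
      by (intro tendsto_intros LIMSEQ_inverse_real_of_nat)
    then have "(\<lambda>n. 2 / (\<alpha> * real (Suc n))) \<longlonglongrightarrow> 0"
      by (simp add: field_simps del: of_nat_Suc)
    then show ?thesis
      unfolding \<epsilon>_def using \<alpha> by (intro tendsto_zero_powrI[where b = "1 / \<alpha>"]) (auto intro!: always_eventually)
  qed
  have J: "real_distribution (sym_pareto \<alpha> (\<epsilon> n))" for n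
    using \<alpha> \<epsilon> by (intro real_distribution_sym_pareto) auto
  have S: "real_distribution (S n)" for n
    unfolding S_def by (intro real_distribution_convolution_power J)
  have conv: "weak_conv_m S M"
  proof (rule levy_continuity[OF S M])
    fix t
    define \<Psi> where "\<Psi> n = (LBINT x:{\<epsilon> n..}. (1 - cos (t * x)) / x powr (\<alpha> + 1))" for n
    have "\<Psi> \<longlonglongrightarrow> (LBINT x:{0<..}. (1 - cos (t * x)) / x powr (\<alpha> + 1))" (is "_ \<longlonglongrightarrow> ?\<Psi>")
      unfolding \<Psi>_def by (intro tendsto_set_integral_atLeast_0 set_integrable_stable_exponent \<alpha> lim\<epsilon> \<epsilon>)
    \<comment> \<open>The limit lemma needs denominator and exponent n, while \<open>S n\<close> has
      n + 1 summands; the index is shifted down here and back up after taking the limit.\<close>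
    then have "(\<lambda>n. \<Psi> (n - 1)) \<longlonglongrightarrow> ?\<Psi>"
      by (subst filterlim_sequentially_Suc[symmetric]) simp
    then have "(\<lambda>n. 2 * \<Psi> (n - 1)) \<longlonglongrightarrow> 2 * ?\<Psi>"
      by (intro tendsto_intros)
    then have "(\<lambda>n. (1 - 2 * \<Psi> (n - 1) / n) ^ n) \<longlonglongrightarrow> exp (- (2 * ?\<Psi>))"
      by (rule tendsto_one_minus_div_power)
        (auto simp: \<Psi>_def set_lebesgue_integral_def intro!: integral_nonneg)
    then have "(\<lambda>n. (1 - 2 * \<Psi> n / Suc n) ^ Suc n) \<longlonglongrightarrow> exp (- 2 * ?\<Psi>)"
      by (auto dest: LIMSEQ_Suc)
    then have "(\<lambda>n. complex_of_real ((1 - 2 * \<Psi> n / Suc n) ^ Suc n)) \<longlonglongrightarrow> char M t"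
      unfolding char by (rule tendsto_of_real)
    moreover have "char (S n) t = complex_of_real ((1 - 2 * \<Psi> n / Suc n) ^ Suc n)" for n
      using \<alpha> unfolding S_def char_convolution_power[OF J] char_sym_pareto[OF \<alpha> \<epsilon>(1)] \<epsilon>(2) \<Psi>_def
      by (simp del: of_nat_Suc)
    ultimately show "(\<lambda>n. char (S n) t) \<longlonglongrightarrow> char M t" by simp
  qed
  \<comment> \<open>A threshold z strictly above y leaves room for a continuous function between the
    indicators of |x| \<ge> z and |x| \<ge> y, as weak convergence requires.\<close>
  have bound: "1 / (2 + \<alpha> * z powr \<alpha>) \<le> measure M {x. \<bar>x\<bar> \<ge> y}" if z: "z > y" for z
  proof -
    \<comment> \<open>A single summand of \<open>S n\<close> exceeds z in absolute value with
      probability \<nu> / (n + 1) once the cutoff is below z.\<close>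
    define \<nu> where "\<nu> = 2 / (\<alpha> * z powr \<alpha>)"
    have \<nu>: "\<nu> > 0" using \<alpha> y z by (simp add: \<nu>_def)
    define f where "f x = max 0 (min 1 ((\<bar>x\<bar> - y) / (z - y)))" for x
    have [measurable]: "f \<in> borel_measurable borel" unfolding f_def by measurable
    have fb: "0 \<le> f x" "f x \<le> 1" for x by (auto simp: f_def)
    have "isCont f x" for x
      unfolding f_def using z by (intro continuous_intros) auto
    then have lim: "(\<lambda>n. integral\<^sup>L (S n) f) \<longlonglongrightarrow> integral\<^sup>L M f"
      using fb by (intro weak_conv_imp_integral_bdd_continuous_conv[OF S M conv, where B = 1]) auto
    have "(\<lambda>n. (1 - \<nu> / n) ^ n) \<longlonglongrightarrow> exp (- \<nu>)"
      using \<nu> by (intro tendsto_one_minus_div_power) auto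
    then have lim': "(\<lambda>n. (1 - (1 - \<nu> / Suc n) ^ Suc n) / 2) \<longlonglongrightarrow> (1 - exp (- \<nu>)) / 2"
      by (intro tendsto_intros LIMSEQ_Suc) auto
    have "eventually (\<lambda>n. \<epsilon> n < z) sequentially"
      using lim\<epsilon> by (rule order_tendstoD(2)) (use y z in simp)
    then have "eventually (\<lambda>n. (1 - (1 - \<nu> / Suc n) ^ Suc n) / 2 \<le> integral\<^sup>L (S n) f) sequentially"
    proof eventually_elim
      case (elim n)
      interpret S: real_distribution "S n" by (rule S)
      have "emeasure (sym_pareto \<alpha> (\<epsilon> n)) {x. \<bar>x\<bar> \<ge> z} = ennreal ((\<epsilon> n / z) powr \<alpha>)"
        using elim \<alpha> \<epsilon>(1)[of n] by (intro emeasure_sym_pareto_abs_ge) auto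
      then have "measure (sym_pareto \<alpha> (\<epsilon> n)) {x. \<bar>x\<bar> \<ge> z} = (\<epsilon> n / z) powr \<alpha>"
        by (simp add: measure_def)
      also have "\<dots> = \<nu> / Suc n"
        using \<epsilon>(1)[of n] y z by (simp add: powr_divide \<epsilon>(2) \<nu>_def)
      finally have q: "measure (sym_pareto \<alpha> (\<epsilon> n)) {x. \<bar>x\<bar> \<ge> z} = \<nu> / Suc n" .
      have "(1 - (1 - \<nu> / Suc n) ^ Suc n) / 2 \<le> measure (S n) {x. \<bar>x\<bar> \<ge> z}"
        using measure_convolution_power_abs_ge[OF J distr_uminus_sym_pareto, of n z "Suc n" 0]
        unfolding q S_def by simp
      also have "\<dots> = integral\<^sup>L (S n) (indicator {x. \<bar>x\<bar> \<ge> z})" by simp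
      also have "\<dots> \<le> integral\<^sup>L (S n) f"
      proof (rule integral_mono)
        show "integrable (S n) f"
          using fb by (intro S.integrable_const_bound[where B = 1]) auto
        show "indicator {x. \<bar>x\<bar> \<ge> z} x \<le> f x" for x
          using z by (auto simp: f_def indicator_def le_divide_eq)
      qed (auto simp: integrable_indicator_iff S.emeasure_eq_measure)
      finally show ?case .
    qed
    then have "(1 - exp (- \<nu>)) / 2 \<le> integral\<^sup>L M f"
      by (rule tendsto_le[OF sequentially_bot lim lim'])
    also have "\<dots> \<le> integral\<^sup>L M (indicator {x. \<bar>x\<bar> \<ge> y})"
    proof (rule integral_mono)
      show "integrable M f"
        using fb by (intro M.integrable_const_bound[where B = 1]) auto
      show "f x \<le> indicator {x. \<bar>x\<bar> \<ge> y} x" for x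
        using z by (auto simp: f_def indicator_def divide_nonpos_pos)
    qed (auto simp: integrable_indicator_iff M.emeasure_eq_measure)
    finally have "(1 - exp (- \<nu>)) / 2 \<le> measure M {x. \<bar>x\<bar> \<ge> y}" by simp
    moreover have "1 / (2 + \<alpha> * z powr \<alpha>) = \<nu> / (1 + \<nu>) / 2"
    proof -
      have "1 / (2 + c) = (2 / c) / (1 + 2 / c) / 2" if "c > 0" for c :: real
        using that by (auto simp: divide_simps)
      then show ?thesis using \<alpha> y z by (simp add: \<nu>_def)
    qed
    moreover have "\<nu> / (1 + \<nu>) / 2 \<le> (1 - exp (- \<nu>)) / 2"
      using one_minus_exp_ge[OF less_imp_le[OF \<nu>]] by (rule divide_right_mono) simp
    ultimately show ?thesis by (simp only:)
  qed
  \<comment> \<open>Right-continuity at y lets z decrease to y.\<close>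
  have "((\<lambda>z. 1 / (2 + \<alpha> * z powr \<alpha>)) \<longlongrightarrow> 1 / (2 + \<alpha> * y powr \<alpha>)) (at_right y)"
    using \<alpha> y by (intro tendsto_intros) (auto simp: add_pos_nonneg less_imp_neq[symmetric])
  then show ?thesis
    by (rule tendsto_upperbound)
      (auto simp: bound intro: eventually_at_rightI[of y "y + 1"])
qed

section \<open>Symmetry and the one-sided tails\<close>

text \<open>Reflection conjugates the characteristic function, so a real one belongs to a symmetric
  law by Levy's uniqueness theorem. For y > 0 the two one-sided tails are disjoint and equally
  likely.\<close>

lemma (in real_distribution) measure_ge_eq_half:
  assumes real: "\<And>t. char M t \<in> \<real>" and y: "y > 0"
  shows "measure M {x. x \<ge> y} = measure M {x. \<bar>x\<bar> \<ge> y} / 2"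
proof -
  have rd: "real_distribution (distr M borel uminus)"
    by (simp add: real_distribution_def real_distribution_axioms_def prob_space_distr)
  have "char (distr M borel uminus) t = char M t" for t
  proof -
    have "iexp (t * - x) = cnj (iexp (t * x))" for x
      by (simp add: complex_eq_iff Re_exp Im_exp)
    then have "char (distr M borel uminus) t = (CLINT x|M. cnj (iexp (t * x)))"
      unfolding char_def by (subst integral_distr) auto
    also have "\<dots> = cnj (char M t)"
      unfolding char_def by simp
    also have "\<dots> = char M t" using real[of t] by (simp add: Reals_cnj_iff)
    finally show ?thesis .
  qed
  then have sym: "distr M borel uminus = M"
    using rd by (intro Levy_uniqueness real_distribution_axioms) auto
  have "measure M {x. x \<le> - y} = measure (distr M borel uminus) {x. x \<ge> y}"
    by (subst measure_distr) (auto intro!: arg_cong2[where f = measure])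
  then have "measure M {x. x \<le> - y} = measure M {x. x \<ge> y}" by (simp add: sym)
  moreover have "measure M ({x. x \<ge> y} \<union> {x. x \<le> - y}) = measure M {x. x \<ge> y} + measure M {x. x \<le> - y}"
    using y by (intro finite_measure_Union) auto
  moreover have "{x. x \<ge> y} \<union> {x. x \<le> - y} = {x. \<bar>x\<bar> \<ge> y}" by auto
  ultimately show ?thesis by simp
qed

theorem theorem7:
  fixes M :: "'a measure" and X :: "'a \<Rightarrow> real" and \<alpha> :: real
  assumes "prob_space M"
    and "X \<in> borel_measurable M"
    and "(0 < \<alpha> \<and> \<alpha> < 1) \<or> (1 < \<alpha> \<and> \<alpha> < 2)"
    and "\<forall>t::real. char (distr M borel X) t =
           complex_of_real (exp (- 2 * (LBINT x:{0<..}. (1 - cos (t * x)) / x powr (\<alpha> + 1))))"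
  shows "(\<forall>y>0. measure M {\<omega> \<in> space M. X \<omega> \<ge> y} \<ge> 1 / 2 * (1 / (2 + \<alpha> * y powr \<alpha>)))
       \<and> (\<alpha> < 1 \<longrightarrow> (\<forall>y>0. measure M {\<omega> \<in> space M. X \<omega> \<ge> y} \<le> 4 / (\<alpha> * y powr \<alpha>)))"
proof -
  interpret prob_space M by fact
  have \<alpha>: "0 < \<alpha>" "\<alpha> < 2" using assms(3) by auto
  interpret D: real_distribution "distr M borel X"
    using assms(2) by (simp add: real_distribution_def real_distribution_axioms_def prob_space_distr)
  note char = assms(4)[rule_format]
  have X: "measure M {\<omega> \<in> space M. X \<omega> \<ge> y} = measure (distr M borel X) {x. \<bar>x\<bar> \<ge> y} / 2" if "y > 0" for y
  proof -
    have "measure M {\<omega> \<in> space M. X \<omega> \<ge> y} = measure (distr M borel X) {x. x \<ge> y}"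
      using assms(2) by (subst measure_distr) (auto intro!: arg_cong2[where f = measure])
    also have "\<dots> = measure (distr M borel X) {x. \<bar>x\<bar> \<ge> y} / 2"
      by (rule D.measure_ge_eq_half[OF _ that]) (simp add: char)
    finally show ?thesis .
  qed
  show ?thesis
  proof (intro conjI allI impI)
    fix y :: real assume y: "y > 0"
    show "measure M {\<omega> \<in> space M. X \<omega> \<ge> y} \<ge> 1 / 2 * (1 / (2 + \<alpha> * y powr \<alpha>))"
      using stable_measure_abs_ge_ge[OF D.real_distribution_axioms \<alpha> y char] unfolding X[OF y] by linarith
  next
    fix y :: real assume \<alpha>1: "\<alpha> < 1" and y: "y > 0"
    \<comment> \<open>Here \<alpha> < 1 enters: (2 - \<alpha>) (\<alpha> + 1) = 2 + \<alpha> (1 -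
      \<alpha>) \<ge> 2, so the constant 16 becomes 8, and symmetry halves it to 4.\<close>
    have "0 \<le> \<alpha> * (1 - \<alpha>)" using \<alpha> \<alpha>1 by simp
    then have "2 \<le> (2 - \<alpha>) * (\<alpha> + 1)" by (simp add: algebra_simps)
    then have "\<alpha> * y powr \<alpha> * 2 \<le> \<alpha> * y powr \<alpha> * ((2 - \<alpha>) * (\<alpha> + 1))"
      using \<alpha> by (intro mult_left_mono) auto
    then have "16 / (\<alpha> * (2 - \<alpha>) * (\<alpha> + 1) * y powr \<alpha>) \<le> 16 / (\<alpha> * y powr \<alpha> * 2)"
      using \<alpha> y by (intro divide_left_mono) (auto simp: mult_ac)
    with D.stable_measure_abs_ge_le[OF \<alpha> y char]
    show "measure M {\<omega> \<in> space M. X \<omega> \<ge> y} \<le> 4 / (\<alpha> * y powr \<alpha>)"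
      unfolding X[OF y] by simp
  qed
qed

end
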